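(* Let $\mathbb{H}_{\mathbb{R}}$ be the quaternion algebra over the real numbers and let $f,g:\mathbb{H}_{\mathbb{R}}\to\mathbb{H}_{\mathbb{R}}$ be $\mathbb{R}$-linear maps such that $f$ is a left $\{g,g\}$-derivation. Then $g$ and $f$ are identically zero.
   Context: $\mathbb{H}_{\mathbb{R}}=\{a+bi+cj+dk\mid a,b,c,d\in\mathbb{R}\}$ with $i^2=j^2=k^2=ijk=-1$. For an algebra $A$ over $\mathbb{R}$ and $\mathbb{R}$-linear maps $f,g,h:A\to A$, $f$ is a left $\{g,h\}$-derivation if $f(ab)=a\,g(b)+b\,h(a)=a\,h(b)+b\,g(a)$ for all $a,b\in A$; a left $\{g,g\}$-derivation is the case $h=g$. *)

theory Defs
  imports Complex_Main
begin

text \<open>\<open>Quat a b c d\<close> is the quaternion \<open>a + b i + c j + d k\<close>.\<close>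

datatype quat = Quat (qre: real) (qi: real) (qj: real) (qk: real)

lemma quat_eq_iff: "x = y \<longleftrightarrow> qre x = qre y \<and> qi x = qi y \<and> qj x = qj y \<and> qk x = qk y"
  by (cases x; cases y) simp

instantiation quat :: real_algebra_1
begin

definition zero_quat :: quat where
  "0 = Quat 0 0 0 0"

definition one_quat :: quat where
  "1 = Quat 1 0 0 0"

definition plus_quat :: "quat \<Rightarrow> quat \<Rightarrow> quat" where
  "x + y = Quat (qre x + qre y) (qi x + qi y) (qj x + qj y) (qk x + qk y)"

definition minus_quat :: "quat \<Rightarrow> quat \<Rightarrow> quat" where
  "x - y = Quat (qre x - qre y) (qi x - qi y) (qj x - qj y) (qk x - qk y)"

definition uminus_quat :: "quat \<Rightarrow> quat" where
  "- x = Quat (- qre x) (- qi x) (- qj x) (- qk x)"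

definition times_quat :: "quat \<Rightarrow> quat \<Rightarrow> quat" where
  "x * y = Quat
     (qre x * qre y - qi x * qi y - qj x * qj y - qk x * qk y)
     (qre x * qi y + qi x * qre y + qj x * qk y - qk x * qj y)
     (qre x * qj y - qi x * qk y + qj x * qre y + qk x * qi y)
     (qre x * qk y + qi x * qj y - qj x * qi y + qk x * qre y)"

definition scaleR_quat :: "real \<Rightarrow> quat \<Rightarrow> quat" where
  "r *\<^sub>R x = Quat (r * qre x) (r * qi x) (r * qj x) (r * qk x)"

lemmas quat_ops_defs = zero_quat_def one_quat_def plus_quat_def minus_quat_def
  uminus_quat_def times_quat_def scaleR_quat_def

instance
  by standard (simp_all add: quat_eq_iff quat_ops_defs algebra_simps)

end

definition quat_i :: quat where "quat_i = Quat 0 1 0 0"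
definition quat_j :: quat where "quat_j = Quat 0 0 1 0"
definition quat_k :: quat where "quat_k = Quat 0 0 0 1"

lemma quat_relations:
  "quat_i ^ 2 = - 1" "quat_j ^ 2 = - 1" "quat_k ^ 2 = - 1"
  "quat_i * quat_j * quat_k = - 1"
  by (simp_all add: quat_eq_iff quat_ops_defs quat_i_def quat_j_def quat_k_def power2_eq_square)

lemma Quat_eq:
  "Quat a b c d = a *\<^sub>R 1 + b *\<^sub>R quat_i + c *\<^sub>R quat_j + d *\<^sub>R quat_k"
  by (simp add: quat_eq_iff quat_ops_defs quat_i_def quat_j_def quat_k_def)

text \<open>Linearity of the three maps is part of the notion, but is kept as a separate
  hypothesis, \<open>linear\<close>, wherever the notion is used.\<close>

definition left_derivation ::
  "('a::real_algebra \<Rightarrow> 'a) \<Rightarrow> ('a \<Rightarrow> 'a) \<Rightarrow> ('a \<Rightarrow> 'a) \<Rightarrow> bool" where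
  "left_derivation g h f \<longleftrightarrow>
     (\<forall>a b. f (a * b) = a * g b + b * h a \<and> f (a * b) = a * h b + b * g a)"

end

theory Submission
  imports Defs
begin

text \<open>Since \<open>f (a b) = f (b a)\<close>, the map \<open>f\<close> kills commutators, hence \<open>i\<close>, \<open>j\<close>, \<open>k\<close>. Then
  \<open>0 = f (1 u) = g u + u (g 1)\<close> for these units \<open>u\<close>, and \<open>f (u u) = 2 u (g u) = 2 (g 1)\<close>, while
  \<open>f (u u) = - f 1 = - 2 (g 1)\<close>; so \<open>g 1 = 0\<close>.\<close>

lemma left_derivation_same_iff:
  "left_derivation g g f \<longleftrightarrow> (\<forall>a b. f (a * b) = a * g b + b * g a)"
  by (simp add: left_derivation_def)

lemma left_derivation_same_commute:
  assumes "left_derivation g g f"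
  shows "f (a * b) = f (b * a)"
  using assms by (simp add: left_derivation_same_iff add.commute)

text \<open>Symmetry of the identity gives \<open>f (a * b) = f (b * a) = - f (a * b)\<close>, and a
  real vector space has no 2-torsion.\<close>

lemma left_derivation_same_anticommute:
  fixes f g :: "'a::real_algebra \<Rightarrow> 'a"
  assumes "linear f" and "left_derivation g g f" and "b * a = - (a * b)"
  shows "f (a * b) = 0"
proof -
  have "f (a * b) = - f (a * b)"
    using left_derivation_same_commute[OF assms(2), of a b] assms(1,3)
    by (simp add: linear_neg)
  then have "2 *\<^sub>R f (a * b) = 0"
    by (simp add: scaleR_2 eq_neg_iff_add_eq_0)
  then show ?thesis by simp
qed

lemma quat_unit_products:
  "quat_j * quat_k = quat_i" "quat_k * quat_j = - quat_i"
  "quat_k * quat_i = quat_j" "quat_i * quat_k = - quat_j"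
  "quat_i * quat_j = quat_k" "quat_j * quat_i = - quat_k"
  by (simp_all add: quat_eq_iff quat_ops_defs quat_i_def quat_j_def quat_k_def)

lemma linear_eq_zero_quatI:
  fixes f :: "quat \<Rightarrow> quat"
  assumes "linear f" "f 1 = 0" "f quat_i = 0" "f quat_j = 0" "f quat_k = 0"
  shows "f = (\<lambda>_. 0)"
proof
  fix x
  show "f x = 0"
    using assms by (cases x) (simp add: Quat_eq linear_add linear_cmul)
qed

theorem theorem5p4:
  fixes f g :: "quat \<Rightarrow> quat"
  assumes "linear f" and "linear g"
    and "left_derivation g g f"
  shows "g = (\<lambda>_. 0) \<and> f = (\<lambda>_. 0)"
proof -
  have D: "f (a * b) = a * g b + b * g a" for a b
    using assms(3) by (simp add: left_derivation_same_iff)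
  \<comment> \<open>Each unit is the product of the other two, and these anticommute.\<close>
  have f_units: "f quat_i = 0" "f quat_j = 0" "f quat_k = 0"
    using left_derivation_same_anticommute[OF assms(1,3), where a = quat_j and b = quat_k]
      left_derivation_same_anticommute[OF assms(1,3), where a = quat_k and b = quat_i]
      left_derivation_same_anticommute[OF assms(1,3), where a = quat_i and b = quat_j]
    by (simp_all add: quat_unit_products)
  have g_kernel: "g u = - (u * g 1)" if "f u = 0" for u
    using D[of 1 u] that by (simp add: eq_neg_iff_add_eq_0)
  have f1: "f 1 = g 1 + g 1"
    using D[of 1 1] by simp
  have i2: "quat_i * quat_i = - 1"
    using quat_relations(1) by (simp add: power2_eq_square)
  have "- (g 1 + g 1) = f (quat_i * quat_i)"
    using assms(1) f1 by (simp add: i2 linear_neg)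
  also have "\<dots> = quat_i * g quat_i + quat_i * g quat_i"
    by (rule D)
  \<comment> \<open>By \<open>g_kernel\<close>, each summand is
    \<open>- (quat_i * quat_i * g 1)\<close>, that is \<open>g 1\<close>.\<close>
  also have "\<dots> = g 1 + g 1"
    by (simp add: g_kernel[OF f_units(1)] mult.assoc[symmetric] i2)
  \<comment> \<open>\<open>g 1 + g 1\<close> equals its own negative, so every real component of
    \<open>g 1\<close> vanishes.\<close>
  finally have g1: "g 1 = 0"
    by (simp add: quat_eq_iff quat_ops_defs)
  have f_zero: "f = (\<lambda>_. 0)"
    using assms(1) f1 f_units g1 by (intro linear_eq_zero_quatI) simp_all
  \<comment> \<open>As \<open>f\<close> is now zero everywhere, \<open>g_kernel\<close> applies to
    every \<open>u\<close>.\<close>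
  have "g u = 0" for u
    using g_kernel[of u] by (simp add: f_zero g1)
  with f_zero show ?thesis
    by auto
qed

end
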